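(* For $v\in[0,1]$ and $n\ge 2$, let $\Gamma_V$ with $V=(v,\dots,v)\in[0,1]^n$ be the $n\times n$ matrix with $\gamma_{ii}=1-v$ for each $i\in[n]$ and $\gamma_{ij}=v$ for all $i\ne j$. (1) For any $\epsilon>0$ and any $v\in[0,1/2]$, there exist $n$ and an $n$-player linear congestion game with altruistic social context $(\mathcal{G},\Gamma)$ with $\Gamma=\Gamma_V$, $V=(v,\dots,v)$, for which $$\mathsf{PoS}(\mathcal{G},\Gamma)\ge\frac{(\sqrt{3}+1)(1-v)}{\sqrt{3}-v(\sqrt{3}-1)}-\epsilon.$$ (2) For any $\epsilon>0$ and any $v\in[1/2,1]$, there exist $n$ and an $n$-player linear congestion game with altruistic social context $(\mathcal{G}',\Gamma')$ with $\Gamma'=\Gamma_V$, $V=(v,\dots,v)$, for which $$\mathsf{PoS}(\mathcal{G}',\Gamma')\ge\frac{3-\sqrt{3}-2v(2-\sqrt{3})}{2(1-v)}-\epsilon,$$ where for $v=1$ this is understood as: for every $M>0$ there is such a game with $\mathsf{PoS}(\mathcal{G}',\Gamma')\ge M$.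
   Context: Linear congestion game: a set of players $[n]=\{1,\dots,n\}$, $n\ge 2$, a finite set $E$ of resources, for each player $i$ a non-empty set $S_i\subseteq 2^E$ of strategies (each strategy is a non-empty subset of $E$), and for each $e\in E$ a latency function $\ell_e(x)=\alpha_e x+\beta_e$ with $\alpha_e,\beta_e\ge 0$. A strategy profile is $S=(s_1,\dots,s_n)$ with $s_i\in S_i$. The congestion of $e$ in $S$ is $n_e(S)=|\{j\in[n]:e\in s_j\}|$, and the cost of player $i$ in the underlying game is $c_i(S)=\sum_{e\in s_i}(\alpha_e n_e(S)+\beta_e)$. For $t\in S_i$, $S_{-i}\diamond t$ denotes the profile obtained from $S$ by replacing $s_i$ with $t$. A linear congestion game with altruistic social context is a pair $(\mathcal{G},\Gamma)$ where $\mathcal{G}$ is a linear congestion game with $n$ players and $\Gamma=(\gamma_{ij})\in\mathbb{R}^{n\times n}$ has non-negative entries; players and strategies are those of $\mathcal{G}$, but the cost of player $i$ in $S$ is $\widehat{c}_i(S)=\sum_{j\in[n]}\gamma_{ij}\,c_j(S)$. A pure Nash equilibrium of $(\mathcal{G},\Gamma)$ is a profile $S$ with $\widehat{c}_i(S)\le\widehat{c}_i(S_{-i}\diamond t)$ for every player $i$ and every $t\in S_i$. The social function is $\mathsf{SUM}(S)=\sum_{i\in[n]}c_i(S)$ (sum of the costs in the underlying game), and $S^*$ is a profile minimizing it. The price of stability $\mathsf{PoS}(\mathcal{G},\Gamma)$ is the minimum of $\mathsf{SUM}(S)/\mathsf{SUM}(S^* )$ over pure Nash equilibria $S$ of $(\mathcal{G},\Gamma)$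 (the set of pure Nash equilibria being non-empty). *)

theory Defs
  imports Complex_Main "HOL-Library.FuncSet"
begin

record 'e congestion_game =
  num_players :: nat
  resources :: "'e set"
  strategies :: "nat \<Rightarrow> 'e set set"
  slope :: "'e \<Rightarrow> real"
  offset :: "'e \<Rightarrow> real"

abbreviation players :: "'e congestion_game \<Rightarrow> nat set" where
  "players G \<equiv> {1..num_players G}"

definition linear_congestion_game :: "'e congestion_game \<Rightarrow> bool" where
  "linear_congestion_game G \<longleftrightarrow>
     num_players G \<ge> 2 \<and>
     finite (resources G) \<and>
     (\<forall>i\<in>players G. strategies G i \<noteq> {} \<and>
        (\<forall>s\<in>strategies G i. s \<noteq> {} \<and> s \<subseteq> resources G)) \<and>
     (\<forall>e\<in>resources G. slope G e \<ge> 0 \<and> offset G e \<ge> 0)"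

definition profiles :: "'e congestion_game \<Rightarrow> (nat \<Rightarrow> 'e set) set" where
  "profiles G = (\<Pi>\<^sub>E i\<in>players G. strategies G i)"

definition congestion :: "'e congestion_game \<Rightarrow> (nat \<Rightarrow> 'e set) \<Rightarrow> 'e \<Rightarrow> nat" where
  "congestion G S e = card {j \<in> players G. e \<in> S j}"

definition cost :: "'e congestion_game \<Rightarrow> nat \<Rightarrow> (nat \<Rightarrow> 'e set) \<Rightarrow> real" where
  "cost G i S = (\<Sum>e\<in>S i. (slope G e * real (congestion G S e) + offset G e))"

text \<open>A social context for an \<open>n\<close>-player game is a matrix indexed by \<open>{1..n}\<close>; entries outside
  this range are irrelevant.\<close>

type_synonym social_context = "nat \<Rightarrow> nat \<Rightarrow> real"

definition altruistic_game :: "'e congestion_game \<Rightarrow> social_context \<Rightarrow> bool" where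
  "altruistic_game G \<Gamma> \<longleftrightarrow>
     linear_congestion_game G \<and> (\<forall>i\<in>players G. \<forall>j\<in>players G. \<Gamma> i j \<ge> 0)"

definition perceived_cost ::
  "'e congestion_game \<Rightarrow> social_context \<Rightarrow> nat \<Rightarrow> (nat \<Rightarrow> 'e set) \<Rightarrow> real" where
  "perceived_cost G \<Gamma> i S = (\<Sum>j\<in>players G. \<Gamma> i j * cost G j S)"

definition pure_nash ::
  "'e congestion_game \<Rightarrow> social_context \<Rightarrow> (nat \<Rightarrow> 'e set) set" where
  "pure_nash G \<Gamma> = {S \<in> profiles G. \<forall>i\<in>players G. \<forall>t\<in>strategies G i.
     perceived_cost G \<Gamma> i S \<le> perceived_cost G \<Gamma> i (S(i := t))}"

definition social_cost :: "'e congestion_game \<Rightarrow> (nat \<Rightarrow> 'e set) \<Rightarrow> real" where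
  "social_cost G S = (\<Sum>i\<in>players G. cost G i S)"

definition optimal_social_cost :: "'e congestion_game \<Rightarrow> real" where
  "optimal_social_cost G = Min (social_cost G ` profiles G)"

lemma finite_profiles: "linear_congestion_game G \<Longrightarrow> finite (profiles G)"
  unfolding profiles_def linear_congestion_game_def
  by (intro finite_PiE finite_atLeastAtMost) (meson PowI finite_Pow_iff finite_subset subsetI)

lemma profiles_nonempty: "linear_congestion_game G \<Longrightarrow> profiles G \<noteq> {}"
  by (auto simp: profiles_def linear_congestion_game_def PiE_eq_empty_iff)

lemma finite_pure_nash: "linear_congestion_game G \<Longrightarrow> finite (pure_nash G \<Gamma>)"
  by (simp add: pure_nash_def finite_profiles)

text \<open>Meaningful only when \<open>pure_nash G \<Gamma>\<close> is non-empty. If the optimum is zero, the convention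
  \<open>x / 0 = 0\<close> makes the value \<open>0\<close>, so a positive lower bound on it is never obtained from
  a vanishing optimum.\<close>

definition price_of_stability :: "'e congestion_game \<Rightarrow> social_context \<Rightarrow> real" where
  "price_of_stability G \<Gamma> =
     Min ((\<lambda>S. social_cost G S / optimal_social_cost G) ` pure_nash G \<Gamma>)"

definition uniform_context :: "real \<Rightarrow> social_context" where
  "uniform_context v i j = (if i = j then 1 - v else v)"

end

theory Submission
  imports Defs "HOL-Library.Nat_Bijection" "HOL-Real_Asymp.Real_Asymp"
begin

text \<open>Arrange resources in a grid. Each of \<open>n\<close> players chooses between a row (together with a hub
  of latency \<open>2 x\<close>, on which \<open>m\<close> further players are stuck) and a column (together with a private
  resource of constant latency \<open>b\<close>). Row \<open>i\<close> and column \<open>j\<close> meet in one resource of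
  latency \<open>x\<close>, so the more players use rows, the more attractive rows become; the slope \<open>2\<close> of the
  hub cancels this effect exactly. Hence the perceived gain of a column player switching to her row
  does not depend on the other players, and tuning \<open>b\<close> gives its sign: either
  everybody uses rows in the unique equilibrium, or everybody uses columns. Comparing the
  two profiles and letting \<open>n \<rightarrow> \<infinity>\<close> with \<open>m / n \<rightarrow> (sqrt 3 - 1) / 2\<close> gives the bounds.
  For \<open>v = 1\<close> the value of \<open>b\<close> has no influence on that gain and can be arbitrarily large.\<close>

section \<open>Uniform contexts, strict dominance and unique equilibria\<close>

text \<open>The diagonal entry splits as \<open>1 - v = v + (1 - 2 * v)\<close>. Only the own cost
  and the total matter, which avoids summing over the other players after a deviation.\<close>

lemma perceived_cost_uniform_context:
  assumes "i \<in> players G"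
  shows "perceived_cost G (uniform_context v) i S = (1 - 2 * v) * cost G i S + v * social_cost G S"
proof -
  have "perceived_cost G (uniform_context v) i S =
    (\<Sum>j\<in>players G. v * cost G j S + (if i = j then (1 - 2 * v) * cost G j S else 0))"
    unfolding perceived_cost_def
    by (intro sum.cong) (auto simp: uniform_context_def algebra_simps)
  then show ?thesis
    using assms by (simp add: sum.distrib sum_distrib_left social_cost_def)
qed

lemma altruistic_game_uniform_context:
  "linear_congestion_game G \<Longrightarrow> 0 \<le> v \<Longrightarrow> v \<le> 1 \<Longrightarrow> altruistic_game G (uniform_context v)"
  by (auto simp: altruistic_game_def uniform_context_def)

lemma fun_upd_profiles:
  "S \<in> profiles G \<Longrightarrow> i \<in> players G \<Longrightarrow> t \<in> strategies G i \<Longrightarrow> S(i := t) \<in> profiles G"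
  by (auto simp: profiles_def PiE_iff extensional_def)

text \<open>\<open>dom\<close> says that \<open>N i\<close> strictly beats every alternative
  whatever the others play. A profile with \<open>S i \<noteq> N i\<close> is therefore improved by
  moving to \<open>N i\<close>; take \<open>t = S i\<close>, for which
  \<open>S(i := t) = S\<close>.\<close>

lemma pure_nash_dominant:
  assumes N: "N \<in> profiles G"
    and dom: "\<And>S i t. S \<in> profiles G \<Longrightarrow> i \<in> players G \<Longrightarrow> t \<in> strategies G i \<Longrightarrow> t \<noteq> N i \<Longrightarrow>
      perceived_cost G \<Gamma> i (S(i := N i)) < perceived_cost G \<Gamma> i (S(i := t))"
  shows "pure_nash G \<Gamma> = {N}"
proof
  have "perceived_cost G \<Gamma> i N \<le> perceived_cost G \<Gamma> i (N(i := t))"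
    if "i \<in> players G" "t \<in> strategies G i" for i t
    using dom[OF N that] by (cases "t = N i") auto
  then show "{N} \<subseteq> pure_nash G \<Gamma>"
    using N by (auto simp: pure_nash_def)
  show "pure_nash G \<Gamma> \<subseteq> {N}"
  proof
    fix S assume "S \<in> pure_nash G \<Gamma>"
    then have S: "S \<in> profiles G"
      and nash: "\<And>i t. i \<in> players G \<Longrightarrow> t \<in> strategies G i \<Longrightarrow>
        perceived_cost G \<Gamma> i S \<le> perceived_cost G \<Gamma> i (S(i := t))"
      by (auto simp: pure_nash_def)
    have "S i = N i" if i: "i \<in> players G" for i
    proof (rule ccontr)
      assume "S i \<noteq> N i"
      moreover have "S i \<in> strategies G i" "N i \<in> strategies G i"
        using S N i by (auto simp: profiles_def)
      ultimately show False
        using dom[OF S i, of "S i"] nash[OF i, of "N i"] by simp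
    qed
    \<comment> \<open>Both profiles are extensional, hence \<open>undefined\<close> off the player
      set.\<close>
    moreover have "S i = N i" if "i \<notin> players G" for i
      using S N that PiE_arb unfolding profiles_def by metis
    ultimately show "S \<in> {N}" by auto
  qed
qed

text \<open>The minimum ranges over a single ratio, and replacing the optimum by the cost of any
  profile \<open>T\<close> only lowers it. Positivity excludes the default value of division by
  zero.\<close>

lemma price_of_stability_unique:
  assumes G: "linear_congestion_game G" and nash: "pure_nash G \<Gamma> = {N}" and T: "T \<in> profiles G"
    and pos: "\<And>S. S \<in> profiles G \<Longrightarrow> social_cost G S > 0"
  shows "price_of_stability G \<Gamma> \<ge> social_cost G N / social_cost G T"
proof -
  have fin: "finite (social_cost G ` profiles G)"
    using finite_profiles[OF G] by simp
  have "optimal_social_cost G \<in> social_cost G ` profiles G"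
    unfolding optimal_social_cost_def using fin T by (intro Min_in) auto
  then have "optimal_social_cost G > 0"
    using pos by auto
  moreover have "optimal_social_cost G \<le> social_cost G T"
    unfolding optimal_social_cost_def using fin T by simp
  moreover have "N \<in> profiles G"
    using nash by (auto simp: pure_nash_def)
  then have "social_cost G N > 0" by (rule pos)
  ultimately show ?thesis
    by (simp add: price_of_stability_def nash frac_le)
qed

section \<open>The grid game\<close>

definition hub :: nat where
  "hub = prod_encode (0, 0)"

text \<open>Pairs are coded as natural numbers so that the game has type
  \<open>nat congestion_game\<close>.\<close>

definition row :: "nat \<Rightarrow> nat \<Rightarrow> nat set" where
  "row n i = prod_encode ` insert (0, 0) ({i} \<times> {1..n})"

definition column :: "nat \<Rightarrow> nat \<Rightarrow> nat set" where
  "column n i = prod_encode ` ({0..n} \<times> {i})"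

text \<open>The pair \<open>(0, 0)\<close> is the hub, \<open>(0, i)\<close> is the private resource of column \<open>i\<close>, and the
  pairs with positive coordinates form the grid.\<close>

definition grid_game :: "nat \<Rightarrow> nat \<Rightarrow> real \<Rightarrow> nat congestion_game" where
  "grid_game n m b = \<lparr>
     num_players = n + m,
     resources = prod_encode ` ({0..n} \<times> {0..n}),
     strategies = (\<lambda>i. if i \<le> n then {row n i, column n i} else {{hub}}),
     slope = (\<lambda>e. case prod_decode e of (i, j) \<Rightarrow> if i > 0 then 1 else if j = 0 then 2 else 0),
     offset = (\<lambda>e. case prod_decode e of (i, j) \<Rightarrow> if i = 0 \<and> j > 0 then b else 0)\<rparr>"

definition row_players :: "nat \<Rightarrow> (nat \<Rightarrow> nat set) \<Rightarrow> nat set" where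
  "row_players n S = {i \<in> {1..n}. S i = row n i}"

lemma grid_game_simps [simp]:
  "num_players (grid_game n m b) = n + m"
  "slope (grid_game n m b) (prod_encode (i, j)) = (if i > 0 then 1 else if j = 0 then 2 else 0)"
  "offset (grid_game n m b) (prod_encode (i, j)) = (if i = 0 \<and> j > 0 then b else 0)"
  "slope (grid_game n m b) hub = 2"
  "offset (grid_game n m b) hub = 0"
  by (auto simp: grid_game_def hub_def)

lemma strategies_grid_game:
  "strategies (grid_game n m b) i = (if i \<le> n then {row n i, column n i} else {{hub}})"
  by (simp add: grid_game_def)

lemma mem_row: "prod_encode (i, j) \<in> row n k \<longleftrightarrow> i = 0 \<and> j = 0 \<or> i = k \<and> j \<in> {1..n}"
  by (auto simp: row_def inj_image_mem_iff[OF inj_prod_encode])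

lemma mem_column: "prod_encode (i, j) \<in> column n k \<longleftrightarrow> i \<le> n \<and> j = k"
  by (auto simp: column_def inj_image_mem_iff[OF inj_prod_encode])

text \<open>The hub lies in every row and in no column with positive index.\<close>

lemma row_neq_column: "i \<ge> 1 \<Longrightarrow> row n i \<noteq> column n i"
  using mem_row[of 0 0 n i] mem_column[of 0 0 n i] by auto

lemma linear_congestion_game_grid_game:
  fixes b :: real
  assumes "n \<ge> 2" "b \<ge> 0"
  shows "linear_congestion_game (grid_game n m b)"
  using assms by (auto simp: linear_congestion_game_def grid_game_def row_def column_def hub_def)

lemma profile_grid_game_cases:
  assumes "S \<in> profiles (grid_game n m b)"
  shows "\<And>i. i \<in> {1..n} \<Longrightarrow> S i = row n i \<or> S i = column n i"
    and "\<And>i. i \<in> {n+1..n+m} \<Longrightarrow> S i = {hub}"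
proof -
  have *: "S i \<in> strategies (grid_game n m b) i" if "i \<in> {1..n+m}" for i
    using assms that by (auto simp: profiles_def)
  show "S i = row n i \<or> S i = column n i" if "i \<in> {1..n}" for i
    using *[of i] that by (auto simp: strategies_grid_game)
  show "S i = {hub}" if "i \<in> {n+1..n+m}" for i
    using *[of i] that by (auto simp: strategies_grid_game)
qed

section \<open>Congestion and costs in an arbitrary profile\<close>

context
  fixes n m :: nat and b :: real and S
  assumes S: "S \<in> profiles (grid_game n m b)"
begin

lemma strategy_eq:
  assumes "j \<in> {1..n}"
  shows "S j = (if j \<in> row_players n S then row n j else column n j)"
  using profile_grid_game_cases(1)[OF S assms] assms by (auto simp: row_players_def)

lemma hub_mem_iff:
  assumes "j \<in> {1..n+m}"
  shows "hub \<in> S j \<longleftrightarrow> j \<in> row_players n S \<or> j > n"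
proof (cases "j \<le> n")
  case True
  then show ?thesis
    using strategy_eq[of j] assms by (simp add: hub_def mem_row mem_column)
next
  case False
  then show ?thesis
    using profile_grid_game_cases(2)[OF S, of j] assms by simp
qed

lemma cell_mem_iff:
  assumes "i \<in> {1..n}" "j \<in> {1..n}" "k \<in> {1..n+m}"
  shows "prod_encode (i, j) \<in> S k \<longleftrightarrow>
    k = i \<and> i \<in> row_players n S \<or> k = j \<and> j \<notin> row_players n S"
proof (cases "k \<le> n")
  case True
  then show ?thesis
    using strategy_eq[of k] assms by (simp add: mem_row mem_column) blast
next
  case False
  then have "S k = {hub}" "k \<noteq> i" "k \<noteq> j"
    using profile_grid_game_cases(2)[OF S, of k] assms by auto
  then show ?thesis
    using assms by (simp add: hub_def)
qed

lemma congestion_hub: "congestion (grid_game n m b) S hub = m + card (row_players n S)"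
proof -
  have sub: "row_players n S \<subseteq> {1..n}"
    by (auto simp: row_players_def)
  have "{j \<in> {1..n+m}. hub \<in> S j} = {j \<in> {1..n+m}. j \<in> row_players n S \<or> j > n}"
    using hub_mem_iff by (intro Collect_cong conj_cong refl)
  also have "\<dots> = row_players n S \<union> {n+1..n+m}"
    using sub by auto
  also have "card (row_players n S \<union> {n+1..n+m}) = card (row_players n S) + m"
    using sub by (subst card_Un_disjoint) (auto intro: finite_subset)
  finally show ?thesis
    by (simp add: congestion_def)
qed

text \<open>Only player \<open>i\<close> through her row and player \<open>j\<close> through her
  column can use cell \<open>(i, j)\<close>. On the diagonal exactly one of the two happens, so the
  formula gives 1 there as well.\<close>

lemma congestion_cell:
  assumes "i \<in> {1..n}" "j \<in> {1..n}"
  shows "congestion (grid_game n m b) S (prod_encode (i, j)) =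
    (if i \<in> row_players n S then 1 else 0) + (if j \<in> row_players n S then 0 else 1)"
proof -
  have "{k \<in> {1..n+m}. prod_encode (i, j) \<in> S k} = {k \<in> {1..n+m}.
      k = i \<and> i \<in> row_players n S \<or> k = j \<and> j \<notin> row_players n S}"
    using cell_mem_iff[OF assms] by (intro Collect_cong conj_cong refl)
  also have "card \<dots> =
      (if i \<in> row_players n S then 1 else 0) + (if j \<in> row_players n S then 0 else 1)"
  proof (cases "i \<in> row_players n S"; cases "j \<in> row_players n S")
    assume "i \<in> row_players n S" "j \<in> row_players n S"
    moreover from this have "{k \<in> {1..n+m}.
        k = i \<and> i \<in> row_players n S \<or> k = j \<and> j \<notin> row_players n S} = {i}"
      using assms by auto
    ultimately show ?thesis by simp
  next
    assume *: "i \<in> row_players n S" "j \<notin> row_players n S"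
    then have "{k \<in> {1..n+m}.
        k = i \<and> i \<in> row_players n S \<or> k = j \<and> j \<notin> row_players n S} = {i, j}"
      using assms by auto
    \<comment> \<open>Off the diagonal the two users are distinct; \<open>i = j\<close> would put
      one player in both modes.\<close>
    moreover have "i \<noteq> j"
      using * by blast
    ultimately show ?thesis
      using * by simp
  next
    assume "i \<notin> row_players n S" "j \<in> row_players n S"
    then show ?thesis by simp
  next
    assume "i \<notin> row_players n S" "j \<notin> row_players n S"
    moreover from this have "{k \<in> {1..n+m}.
        k = i \<and> i \<in> row_players n S \<or> k = j \<and> j \<notin> row_players n S} = {j}"
      using assms by auto
    ultimately show ?thesis by simp
  qed
  finally show ?thesis
    by (simp add: congestion_def)
qed

lemma sum_row_players:
  fixes x y :: real
  shows "(\<Sum>j\<in>{1..n}. if j \<in> row_players n S then x else y) =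
     card (row_players n S) * x + (real n - card (row_players n S)) * y"
proof -
  have sub: "row_players n S \<subseteq> {1..n}"
    by (auto simp: row_players_def)
  then have "{1..n} \<inter> {j. j \<in> row_players n S} = row_players n S"
    "{1..n} \<inter> - {j. j \<in> row_players n S} = {1..n} - row_players n S"
    by auto
  moreover have "card (row_players n S) \<le> n"
    using card_mono[OF _ sub] by simp
  ultimately show ?thesis
    using sub by (simp add: sum.If_cases card_Diff_subset finite_subset[OF sub] of_nat_diff)
qed

text \<open>With \<open>k\<close> row players, the row has \<open>k\<close> cells of congestion 1
  and \<open>n - k\<close> of congestion 2, in total \<open>2 * n - k\<close>. The hub adds
  \<open>2 * (m + k)\<close>, so its slope 2 turns \<open>- k\<close> into \<open>+ k\<close>, the
  same dependence on \<open>k\<close> as for a column.\<close>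

lemma cost_row:
  assumes "i \<in> row_players n S"
  shows "cost (grid_game n m b) i S = 2 * n + card (row_players n S) + 2 * m"
proof -
  have i: "i \<in> {1..n}" "S i = row n i"
    using assms by (auto simp: row_players_def)
  have row: "row n i = insert hub (prod_encode ` Pair i ` {1..n})"
    by (auto simp: row_def hub_def)
  have "hub \<notin> prod_encode ` Pair i ` {1..n}"
    using i by (auto simp: hub_def)
  then have "cost (grid_game n m b) i S = 2 * (m + card (row_players n S)) +
      (\<Sum>j\<in>{1..n}. real (congestion (grid_game n m b) S (prod_encode (i, j))))"
    using i by (simp add: cost_def row congestion_hub sum.reindex inj_on_def)
  also have "(\<Sum>j\<in>{1..n}. real (congestion (grid_game n m b) S (prod_encode (i, j)))) =
      (\<Sum>j\<in>{1..n}. if j \<in> row_players n S then 1 else 2)"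
    using i assms by (intro sum.cong refl) (simp add: congestion_cell)
  finally show ?thesis
    by (simp add: sum_row_players algebra_simps del: One_nat_def)
qed

lemma cost_column:
  assumes "i \<in> {1..n}" "i \<notin> row_players n S"
  shows "cost (grid_game n m b) i S = n + card (row_players n S) + b"
proof -
  have i: "S i = column n i"
    using assms profile_grid_game_cases(1)[OF S, of i] by (auto simp: row_players_def)
  have col: "column n i = insert (prod_encode (0, i)) (prod_encode ` (\<lambda>j. (j, i)) ` {1..n})"
    by (force simp: column_def image_iff)
  have "prod_encode (0, i) \<notin> prod_encode ` (\<lambda>j. (j, i)) ` {1..n}"
    by auto
  then have "cost (grid_game n m b) i S = b +
      (\<Sum>j\<in>{1..n}. real (congestion (grid_game n m b) S (prod_encode (j, i))))"
    using assms i by (simp add: cost_def col sum.reindex inj_on_def)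
  also have "(\<Sum>j\<in>{1..n}. real (congestion (grid_game n m b) S (prod_encode (j, i)))) =
      (\<Sum>j\<in>{1..n}. if j \<in> row_players n S then 2 else 1)"
    using assms by (intro sum.cong refl) (simp add: congestion_cell)
  finally show ?thesis
    by (simp add: sum_row_players algebra_simps del: One_nat_def)
qed

lemma cost_hub:
  assumes "i \<in> {n+1..n+m}"
  shows "cost (grid_game n m b) i S = 2 * (m + card (row_players n S))"
  using profile_grid_game_cases(2)[OF S assms] by (simp add: cost_def congestion_hub)

text \<open>The terms quadratic in the number of row players cancel. The total is thus affine in
  that number, and each switch to a row changes it by the same amount.\<close>

lemma social_cost_grid_game:
  "social_cost (grid_game n m b) S =
     (real n)\<^sup>2 + 2 * (real m)\<^sup>2 + b * real n + card (row_players n S) * (2 * n + 4 * m - b)"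
proof -
  let ?k = "card (row_players n S)"
  have "{1..n+m} = {1..n} \<union> {n+1..n+m}" by auto
  then have "social_cost (grid_game n m b) S =
      (\<Sum>i\<in>{1..n}. cost (grid_game n m b) i S) + (\<Sum>i\<in>{n+1..n+m}. cost (grid_game n m b) i S)"
    by (simp add: social_cost_def sum.union_disjoint)
  also have "(\<Sum>i\<in>{1..n}. cost (grid_game n m b) i S) =
      (\<Sum>i\<in>{1..n}. if i \<in> row_players n S then 2 * n + ?k + 2 * m else n + ?k + b)"
    by (intro sum.cong refl) (simp add: cost_row cost_column)
  also have "(\<Sum>i\<in>{n+1..n+m}. cost (grid_game n m b) i S) = m * (2 * (m + ?k))"
    by (simp add: cost_hub)
  finally show ?thesis
    by (simp add: sum_row_players algebra_simps power2_eq_square del: One_nat_def)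
qed

lemma social_cost_grid_game_pos:
  assumes "n \<ge> 1" "b \<ge> 0"
  shows "social_cost (grid_game n m b) S > 0"
proof -
  let ?k = "card (row_players n S)"
  have "row_players n S \<subseteq> {1..n}"
    by (auto simp: row_players_def)
  then have "?k \<le> n"
    using card_mono[of "{1..n}" "row_players n S"] by simp
  then have "0 \<le> b * (real n - ?k)"
    using assms by simp
  moreover have "0 < (real n)\<^sup>2" "0 \<le> (real m)\<^sup>2" "0 \<le> real (?k * (2 * n + 4 * m))"
    using assms by simp_all
  \<comment> \<open>The coefficient \<open>2 * n + 4 * m - b\<close> may be negative, so the terms
    in \<open>b\<close> are collected into \<open>b * (n - k)\<close>, with \<open>k\<close> at most
    \<open>n\<close>.\<close>
  moreover have "social_cost (grid_game n m b) S =
      (real n)\<^sup>2 + 2 * (real m)\<^sup>2 + b * (real n - ?k) + real (?k * (2 * n + 4 * m))"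
    unfolding social_cost_grid_game by (simp add: algebra_simps)
  ultimately show ?thesis by linarith
qed

text \<open>The own cost changes by \<open>n + 2 * m + 1 - b\<close>, where the 1 arises because the
  switching player joins the row players. The social cost changes by
  \<open>2 * n + 4 * m - b\<close>. Weighting these by \<open>1 - 2 * v\<close> and \<open>v\<close>
  leaves no trace of the other players.\<close>

lemma perceived_cost_row_minus_column:
  fixes v :: real
  assumes i: "i \<in> {1..n}"
  shows "perceived_cost (grid_game n m b) (uniform_context v) i (S(i := row n i)) -
    perceived_cost (grid_game n m b) (uniform_context v) i (S(i := column n i)) =
    real n + 2 * real m + 1 - 2 * v - (1 - v) * b"
proof -
  let ?R = "S(i := row n i)" and ?C = "S(i := column n i)"
  have "?R \<in> profiles (grid_game n m b)" "?C \<in> profiles (grid_game n m b)"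
    using i by (auto intro!: fun_upd_profiles S simp: strategies_grid_game)
  note prof = this
  have eq: "row_players n ?R = insert i (row_players n ?C)" and notin: "i \<notin> row_players n ?C"
    using i row_neq_column[of i n] by (auto simp: row_players_def)
  have "finite (row_players n ?C)"
    by (simp add: row_players_def)
  then have card: "card (row_players n ?R) = card (row_players n ?C) + 1"
    using eq notin by simp
  define k where "k = real (card (row_players n ?C))"
  have player: "i \<in> players (grid_game n m b)"
    using i by simp
  have row: "perceived_cost (grid_game n m b) (uniform_context v) i ?R =
    (1 - 2 * v) * (2 * real n + (1 + k) + 2 * real m) +
    v * ((real n)\<^sup>2 + 2 * (real m)\<^sup>2 + b * real n + (1 + k) * (2 * real n + 4 * real m - b))"
    \<comment> \<open>The costs are needed at the modified profiles rather than at the fixed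
      \<open>S\<close>, hence the generalised versions of these lemmas.\<close>
    using Submission.cost_row[OF prof(1)] Submission.social_cost_grid_game[OF prof(1)] card eq
    by (simp add: perceived_cost_uniform_context[OF player] k_def)
  have col: "perceived_cost (grid_game n m b) (uniform_context v) i ?C =
    (1 - 2 * v) * (real n + k + b) +
    v * ((real n)\<^sup>2 + 2 * (real m)\<^sup>2 + b * real n + k * (2 * real n + 4 * real m - b))"
    using Submission.cost_column[OF prof(2) i notin] Submission.social_cost_grid_game[OF prof(2)]
    by (simp add: perceived_cost_uniform_context[OF player] k_def)
  show ?thesis
    unfolding row col by algebra
qed

end

section \<open>The all-row and all-column profiles as unique equilibria\<close>

definition uniform_profile :: "nat \<Rightarrow> nat \<Rightarrow> (nat \<Rightarrow> nat set) \<Rightarrow> nat \<Rightarrow> nat set" where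
  "uniform_profile n m s = (\<lambda>i\<in>{1..n+m}. if i \<le> n then s i else {hub})"

lemma row_profile: "uniform_profile n m (row n) \<in> profiles (grid_game n m b)"
  and column_profile: "uniform_profile n m (column n) \<in> profiles (grid_game n m b)"
  by (simp_all add: uniform_profile_def profiles_def strategies_grid_game restrict_PiE_iff)

text \<open>Nobody uses a private resource here, so \<open>b\<close> drops out.\<close>

lemma social_cost_row_profile:
  fixes b :: real
  shows "social_cost (grid_game n m b) (uniform_profile n m (row n)) = (real n)\<^sup>2 + 2 * (real n + real m)\<^sup>2"
proof -
  have "row_players n (uniform_profile n m (row n)) = {1..n}"
    by (auto simp: row_players_def uniform_profile_def)
  then show ?thesis
    by (simp add: social_cost_grid_game[OF row_profile] algebra_simps power2_eq_square)
qed

lemma social_cost_column_profile: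
  fixes b :: real
  shows "social_cost (grid_game n m b) (uniform_profile n m (column n)) = (real n)\<^sup>2 + 2 * (real m)\<^sup>2 + b * real n"
proof -
  have "i \<notin> row_players n (uniform_profile n m (column n))" for i
    using row_neq_column[of i n] by (auto simp: row_players_def uniform_profile_def)
  then have "row_players n (uniform_profile n m (column n)) = {}"
    by blast
  then show ?thesis
    by (simp add: social_cost_grid_game[OF column_profile])
qed

text \<open>The hypothesis makes the perceived row-minus-column difference negative, so rows are
  strictly dominant. The players on the hub have no alternative strategy.\<close>

lemma pure_nash_row_profile:
  fixes v b :: real
  assumes "real n + 2 * real m + 1 - 2 * v < (1 - v) * b"
  shows "pure_nash (grid_game n m b) (uniform_context v) = {uniform_profile n m (row n)}"
proof (rule pure_nash_dominant[OF row_profile])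
  fix S i t
  assume "S \<in> profiles (grid_game n m b)" "i \<in> players (grid_game n m b)"
    and "t \<in> strategies (grid_game n m b) i" "t \<noteq> uniform_profile n m (row n) i"
  then show "perceived_cost (grid_game n m b) (uniform_context v) i
      (S(i := uniform_profile n m (row n) i)) <
    perceived_cost (grid_game n m b) (uniform_context v) i (S(i := t))"
    using perceived_cost_row_minus_column[of S n m b i v] assms
    by (auto simp: uniform_profile_def strategies_grid_game split: if_splits)
qed

lemma pure_nash_column_profile:
  fixes v b :: real
  assumes "real n + 2 * real m + 1 - 2 * v > (1 - v) * b"
  shows "pure_nash (grid_game n m b) (uniform_context v) = {uniform_profile n m (column n)}"
proof (rule pure_nash_dominant[OF column_profile])
  fix S i t
  assume "S \<in> profiles (grid_game n m b)" "i \<in> players (grid_game n m b)"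
    and "t \<in> strategies (grid_game n m b) i" "t \<noteq> uniform_profile n m (column n) i"
  then show "perceived_cost (grid_game n m b) (uniform_context v) i
      (S(i := uniform_profile n m (column n) i)) <
    perceived_cost (grid_game n m b) (uniform_context v) i (S(i := t))"
    using perceived_cost_row_minus_column[of S n m b i v] assms
    by (auto simp: uniform_profile_def strategies_grid_game split: if_splits)
qed

lemma price_of_stability_row:
  fixes v b :: real
  assumes "n \<ge> 2" "b \<ge> 0" "real n + 2 * real m + 1 - 2 * v < (1 - v) * b"
  shows "price_of_stability (grid_game n m b) (uniform_context v) \<ge>
    ((real n)\<^sup>2 + 2 * (real n + real m)\<^sup>2) / ((real n)\<^sup>2 + 2 * (real m)\<^sup>2 + b * real n)"
  using price_of_stability_unique[OF linear_congestion_game_grid_game[OF assms(1,2)]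
      pure_nash_row_profile[OF assms(3)] column_profile] assms
  by (simp add: social_cost_row_profile social_cost_column_profile social_cost_grid_game_pos)

lemma price_of_stability_column:
  fixes v b :: real
  assumes "n \<ge> 2" "b \<ge> 0" "real n + 2 * real m + 1 - 2 * v > (1 - v) * b"
  shows "price_of_stability (grid_game n m b) (uniform_context v) \<ge>
    ((real n)\<^sup>2 + 2 * (real m)\<^sup>2 + b * real n) / ((real n)\<^sup>2 + 2 * (real n + real m)\<^sup>2)"
  using price_of_stability_unique[OF linear_congestion_game_grid_game[OF assms(1,2)]
      pure_nash_column_profile[OF assms(3)] row_profile] assms
  by (simp add: social_cost_row_profile social_cost_column_profile social_cost_grid_game_pos)

section \<open>Limits of the cost ratios\<close>

text \<open>The factor is the positive root \<mu> of \<open>2 * \<mu>^2 + 2 * \<mu> = 1\<close>, a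
  critical point of the limiting ratio for every \<open>v < 1\<close> as a function of
  \<open>m / n\<close>. It maximises row cost over column cost when \<open>v < 1/2\<close> and the
  inverse ratio when \<open>v > 1/2\<close>.\<close>

definition hub_players :: "nat \<Rightarrow> nat" where
  "hub_players n = nat \<lfloor>(sqrt 3 - 1) / 2 * n\<rfloor>"

lemma hub_players_ratio_tendsto: "(\<lambda>n. hub_players n / n) \<longlonglongrightarrow> (sqrt 3 - 1) / 2"
proof -
  define \<mu> :: real where "\<mu> = (sqrt 3 - 1) / 2"
  have pos: "\<mu> > 0"
    by (simp add: \<mu>_def)
  then have "real (hub_players n) = of_int \<lfloor>\<mu> * n\<rfloor>" for n
    by (simp add: hub_players_def \<mu>_def)
  moreover have "(\<lambda>n::nat. of_int \<lfloor>\<mu> * n\<rfloor> / n) \<longlonglongrightarrow> \<mu>"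
    using pos by real_asymp
  ultimately show ?thesis
    by (simp add: \<mu>_def)
qed

text \<open>The private cost at which the perceived gain of a switch from column to row is \<open>c\<close>.\<close>

definition private_cost :: "real \<Rightarrow> real \<Rightarrow> nat \<Rightarrow> real" where
  "private_cost v c n = (real n + 2 * real (hub_players n) + 1 - 2 * v + c) / (1 - v)"

text \<open>Dividing both social costs by the square of \<open>n\<close> leaves quadratics in \<mu>.
  The constant \<open>1 - 2 * v + c\<close> of the private cost vanishes in the limit, so making the
  preference strict costs nothing.\<close>

lemma social_cost_ratio_tendsto:
  fixes v c :: real
  assumes v: "0 \<le> v" "v < 1"
  defines "A \<equiv> \<lambda>n. ((real n)\<^sup>2 + 2 * (real n + real (hub_players n))\<^sup>2)"
    and "B \<equiv> \<lambda>n. (real n)\<^sup>2 + 2 * (real (hub_players n))\<^sup>2 + private_cost v c n * real n"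
  shows "(\<lambda>n. A n / B n) \<longlonglongrightarrow> (sqrt 3 + 1) * (1 - v) / (sqrt 3 - v * (sqrt 3 - 1))"
    and "(\<lambda>n. B n / A n) \<longlonglongrightarrow> (3 - sqrt 3 - 2 * v * (2 - sqrt 3)) / (2 * (1 - v))"
proof -
  define \<mu> :: real where "\<mu> = (sqrt 3 - 1) / 2"
  have \<mu>: "\<mu>\<^sup>2 = 1 - sqrt 3 / 2" "\<mu> > 0"
    by (simp_all add: \<mu>_def power2_eq_square field_simps)
  define x where "x n = real (hub_players n) / n" for n
  have x: "x \<longlonglongrightarrow> \<mu>"
    using hub_players_ratio_tendsto unfolding x_def \<mu>_def .
  have "(\<lambda>n. 1 + 2 * (1 + x n)\<^sup>2) \<longlonglongrightarrow> 1 + 2 * (1 + \<mu>)\<^sup>2"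
    by (intro tendsto_intros x)
  moreover have "\<forall>\<^sub>F n in sequentially. 1 + 2 * (1 + x n)\<^sup>2 = A n / (real n)\<^sup>2"
    using eventually_gt_at_top[of 0]
    by eventually_elim (simp add: A_def x_def power2_eq_square field_simps)
  ultimately have A: "(\<lambda>n. A n / (real n)\<^sup>2) \<longlonglongrightarrow> 1 + 2 * (1 + \<mu>)\<^sup>2"
    by (rule Lim_transform_eventually)
  have "(\<lambda>n. 1 + 2 * (x n)\<^sup>2 + (1 + 2 * x n + (1 - 2 * v + c) / real n) / (1 - v))
    \<longlonglongrightarrow> 1 + 2 * \<mu>\<^sup>2 + (1 + 2 * \<mu> + 0) / (1 - v)"
    using v by (intro tendsto_intros x lim_const_over_n) auto
  moreover have "\<forall>\<^sub>F n in sequentially.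
      1 + 2 * (x n)\<^sup>2 + (1 + 2 * x n + (1 - 2 * v + c) / real n) / (1 - v) = B n / (real n)\<^sup>2"
    using eventually_gt_at_top[of 0]
  proof eventually_elim
    case (elim n)
    have "private_cost v c n * n / (real n)\<^sup>2 = (1 + 2 * x n + (1 - 2 * v + c) / real n) / (1 - v)"
      using elim v by (simp add: private_cost_def x_def power2_eq_square field_simps)
    then show ?case
      using elim by (simp add: B_def x_def add_divide_distrib power_divide)
  qed
  ultimately have B: "(\<lambda>n. B n / (real n)\<^sup>2) \<longlonglongrightarrow> 1 + 2 * \<mu>\<^sup>2 + (1 + 2 * \<mu> + 0) / (1 - v)"
    by (rule Lim_transform_eventually)
  have limA: "1 + 2 * (1 + \<mu>)\<^sup>2 = 3 + sqrt 3"
    by (simp add: \<mu> power2_sum) (simp add: \<mu>_def field_simps)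
  have limB: "1 + 2 * \<mu>\<^sup>2 + (1 + 2 * \<mu> + 0) / (1 - v) = (3 - v * (3 - sqrt 3)) / (1 - v)"
    using v by (simp add: \<mu>) (simp add: \<mu>_def field_simps)
  \<comment> \<open>This keeps the limit of the scaled column cost away from zero, as the quotient
    of limits requires.\<close>
  have "v * (3 - sqrt 3) \<le> 1 * (3 - sqrt 3)"
    using v real_le_lsqrt[of 3 3] by (intro mult_right_mono) auto
  then have den: "3 - v * (3 - sqrt 3) > 0"
    by (simp add: order_le_less_trans)
  have cancel: "(f n / (real n)\<^sup>2) / (g n / (real n)\<^sup>2) = f n / g n" if "n > 0" for f g :: "nat \<Rightarrow> real" and n
    using that by simp
  have "(\<lambda>n. (A n / (real n)\<^sup>2) / (B n / (real n)\<^sup>2)) \<longlonglongrightarrow> (3 + sqrt 3) / ((3 - v * (3 - sqrt 3)) / (1 - v))"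
    using tendsto_divide[OF A B] v den unfolding limA limB by simp
  moreover have "\<forall>\<^sub>F n in sequentially. (A n / (real n)\<^sup>2) / (B n / (real n)\<^sup>2) = A n / B n"
    using eventually_gt_at_top[of 0] by eventually_elim (rule cancel)
  ultimately have "(\<lambda>n. A n / B n) \<longlonglongrightarrow> (3 + sqrt 3) / ((3 - v * (3 - sqrt 3)) / (1 - v))"
    by (rule Lim_transform_eventually)
  \<comment> \<open>A factor \<open>sqrt 3\<close> is extracted from numerator and
    denominator.\<close>
  moreover have "(3 + sqrt 3) / ((3 - v * (3 - sqrt 3)) / (1 - v)) =
      (sqrt 3 * ((sqrt 3 + 1) * (1 - v))) / (sqrt 3 * (sqrt 3 - v * (sqrt 3 - 1)))"
    by (simp add: algebra_simps)
  ultimately show "(\<lambda>n. A n / B n) \<longlonglongrightarrow> (sqrt 3 + 1) * (1 - v) / (sqrt 3 - v * (sqrt 3 - 1))"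
    by simp
  have pos3: "3 + sqrt 3 > 0"
    by (simp add: add_pos_pos)
  have "(\<lambda>n. (B n / (real n)\<^sup>2) / (A n / (real n)\<^sup>2)) \<longlonglongrightarrow> ((3 - v * (3 - sqrt 3)) / (1 - v)) / (3 + sqrt 3)"
    using tendsto_divide[OF B A] pos3 unfolding limA limB by simp
  moreover have "\<forall>\<^sub>F n in sequentially. (B n / (real n)\<^sup>2) / (A n / (real n)\<^sup>2) = B n / A n"
    using eventually_gt_at_top[of 0] by eventually_elim (rule cancel)
  ultimately have "(\<lambda>n. B n / A n) \<longlonglongrightarrow> ((3 - v * (3 - sqrt 3)) / (1 - v)) / (3 + sqrt 3)"
    by (rule Lim_transform_eventually)
  moreover have "((3 - v * (3 - sqrt 3)) / (1 - v)) / (3 + sqrt 3) =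
      (3 - sqrt 3 - 2 * v * (2 - sqrt 3)) / (2 * (1 - v))"
    using v pos3 by (simp add: frac_eq_eq) (simp add: algebra_simps)
  ultimately show "(\<lambda>n. B n / A n) \<longlonglongrightarrow> (3 - sqrt 3 - 2 * v * (2 - sqrt 3)) / (2 * (1 - v))"
    by simp
qed

section \<open>Choice of the parameters in the three ranges of \<open>v\<close>\<close>

theorem theorem10:
  "(\<forall>\<epsilon>>0. \<forall>v\<in>{0..1/2::real}. \<exists>n. \<exists>G :: nat congestion_game.
      num_players G = n \<and> altruistic_game G (uniform_context v) \<and>
      pure_nash G (uniform_context v) \<noteq> {} \<and>
      price_of_stability G (uniform_context v)
        \<ge> (sqrt 3 + 1) * (1 - v) / (sqrt 3 - v * (sqrt 3 - 1)) - \<epsilon>) \<and>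
   (\<forall>\<epsilon>>0. \<forall>v\<in>{1/2..<1::real}. \<exists>n. \<exists>G :: nat congestion_game.
      num_players G = n \<and> altruistic_game G (uniform_context v) \<and>
      pure_nash G (uniform_context v) \<noteq> {} \<and>
      price_of_stability G (uniform_context v)
        \<ge> (3 - sqrt 3 - 2 * v * (2 - sqrt 3)) / (2 * (1 - v)) - \<epsilon>) \<and>
   (\<forall>M>0. \<exists>n. \<exists>G :: nat congestion_game.
      num_players G = n \<and> altruistic_game G (uniform_context 1) \<and>
      pure_nash G (uniform_context 1) \<noteq> {} \<and>
      price_of_stability G (uniform_context 1) \<ge> M)"
proof (intro conjI allI ballI impI)
  fix \<epsilon> v :: real
  assume \<epsilon>: "\<epsilon> > 0" and v: "v \<in> {0..1/2}"
  let ?L = "(sqrt 3 + 1) * (1 - v) / (sqrt 3 - v * (sqrt 3 - 1))"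
  \<comment> \<open>Taking \<open>c = 1\<close> makes a row better than a column by exactly 1, so
    the all-row profile is the equilibrium.\<close>
  have "\<forall>\<^sub>F n in sequentially. ((real n)\<^sup>2 + 2 * (real n + real (hub_players n))\<^sup>2) /
      ((real n)\<^sup>2 + 2 * (real (hub_players n))\<^sup>2 + private_cost v 1 n * real n) > ?L - \<epsilon>"
    using order_tendstoD(1)[OF social_cost_ratio_tendsto(1)[of v 1], of "?L - \<epsilon>"] v \<epsilon> by simp
  then obtain n where n: "n \<ge> 2" "((real n)\<^sup>2 + 2 * (real n + real (hub_players n))\<^sup>2) /
      ((real n)\<^sup>2 + 2 * (real (hub_players n))\<^sup>2 + private_cost v 1 n * real n) > ?L - \<epsilon>"
    using eventually_happens[OF eventually_conj[OF eventually_ge_at_top[of "2::nat"]]]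
    by force
  define m b where "m = hub_players n" and "b = private_cost v 1 n"
  have b: "b \<ge> 0" "(1 - v) * b = real n + 2 * real m + 2 - 2 * v"
    using v by (auto simp: b_def m_def private_cost_def intro!: divide_nonneg_nonneg)
  then have dom: "real n + 2 * real m + 1 - 2 * v < (1 - v) * b" by simp
  \<comment> \<open>The number of players is \<open>n + m\<close>, counting those fixed on the
    hub.\<close>
  show "\<exists>n G. num_players (G :: nat congestion_game) = n \<and>
      altruistic_game G (uniform_context v) \<and> pure_nash G (uniform_context v) \<noteq> {} \<and>
      price_of_stability G (uniform_context v) \<ge> ?L - \<epsilon>"
    using n v b price_of_stability_row[OF n(1) b(1) dom] pure_nash_row_profile[OF dom]
    by (intro exI[of _ "n + m"] exI[of _ "grid_game n m b"])
      (auto simp: m_def b_def intro!: altruistic_game_uniform_context linear_congestion_game_grid_game)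
next
  fix \<epsilon> v :: real
  assume \<epsilon>: "\<epsilon> > 0" and v: "v \<in> {1/2..<1}"
  let ?L = "(3 - sqrt 3 - 2 * v * (2 - sqrt 3)) / (2 * (1 - v))"
  \<comment> \<open>With \<open>c = -1\<close> the preference is reversed and the all-column profile
    is the equilibrium.\<close>
  have "\<forall>\<^sub>F n in sequentially. ((real n)\<^sup>2 + 2 * (real (hub_players n))\<^sup>2 + private_cost v (-1) n * real n) /
      ((real n)\<^sup>2 + 2 * (real n + real (hub_players n))\<^sup>2) > ?L - \<epsilon>"
    using order_tendstoD(1)[OF social_cost_ratio_tendsto(2)[of v "-1"], of "?L - \<epsilon>"] v \<epsilon> by simp
  then obtain n where n: "n \<ge> 2" "((real n)\<^sup>2 + 2 * (real (hub_players n))\<^sup>2 + private_cost v (-1) n * real n) /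
      ((real n)\<^sup>2 + 2 * (real n + real (hub_players n))\<^sup>2) > ?L - \<epsilon>"
    using eventually_happens[OF eventually_conj[OF eventually_ge_at_top[of "2::nat"]]]
    by force
  define m b where "m = hub_players n" and "b = private_cost v (-1) n"
  \<comment> \<open>Nonnegativity of \<open>b\<close> comes from \<open>n \<ge> 2\<close> and
    \<open>v < 1\<close>.\<close>
  have b: "b \<ge> 0" "(1 - v) * b = real n + 2 * real m - 2 * v"
    using v n(1) by (auto simp: b_def m_def private_cost_def intro!: divide_nonneg_nonneg)
  then have dom: "real n + 2 * real m + 1 - 2 * v > (1 - v) * b" by simp
  show "\<exists>n G. num_players (G :: nat congestion_game) = n \<and>
      altruistic_game G (uniform_context v) \<and> pure_nash G (uniform_context v) \<noteq> {} \<and>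
      price_of_stability G (uniform_context v) \<ge> ?L - \<epsilon>"
    using n v b price_of_stability_column[OF n(1) b(1) dom] pure_nash_column_profile[OF dom]
    by (intro exI[of _ "n + m"] exI[of _ "grid_game n m b"])
      (auto simp: m_def b_def intro!: altruistic_game_uniform_context linear_congestion_game_grid_game)
next
  fix M :: real
  assume M: "M > 0"
  \<comment> \<open>For \<open>v = 1\<close> the difference is 1 whatever \<open>b\<close> is. With
    two grid players, no hub players and \<open>b = 6 * M\<close>, the cost ratio is
    \<open>(4 + 12 * M) / 12\<close>, which exceeds \<open>M\<close>.\<close>
  have dom: "real 2 + 2 * real 0 + 1 - 2 * 1 > (1 - 1) * (6 * M)" by simp
  have "price_of_stability (grid_game 2 0 (6 * M)) (uniform_context 1) \<ge> M"
    using price_of_stability_column[OF _ _ dom] M by simp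
  then show "\<exists>n G. num_players (G :: nat congestion_game) = n \<and>
      altruistic_game G (uniform_context 1) \<and> pure_nash G (uniform_context 1) \<noteq> {} \<and>
      price_of_stability G (uniform_context 1) \<ge> M"
    using M pure_nash_column_profile[OF dom]
    by (intro exI[of _ 2] exI[of _ "grid_game 2 0 (6 * M)"])
      (auto intro!: altruistic_game_uniform_context linear_congestion_game_grid_game)
qed

end
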